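(* Let $\mathfrak{g}=\mathfrak{g}_{3.4}^0\oplus\mathfrak{g}_1$ be the four-dimensional real Lie algebra with basis $\mathcal{B}=\{e_1,e_2,e_3,e_4\}$ whose nonzero Lie brackets (up to skew-symmetry) are $[e_2,e_3]=e_1$, $[e_3,e_1]=-e_2$. Let $\langle\cdot,\cdot\rangle$ be a pseudo-Riemannian inner product on $\mathfrak{g}$ and let $(R_{ij})$ be the matrix of its Ricci operator $\operatorname{Ric}$ in the basis $\mathcal{B}$. If $$R_{i1}=R_{i2}=0\ (i=3,4),\quad R_{i4}=0\ (i=1,2,3),\quad R_{21}=R_{12},\quad R_{22}=R_{11},$$ then $\langle\cdot,\cdot\rangle$ is an algebraic Ricci soliton. In this situation, $\operatorname{Ric}=\eta I_4+D$ where $\eta=R_{33}$ and $$D=\begin{bmatrix}R_{11}-R_{33}&R_{12}&R_{13}&0\\R_{12}&R_{11}-R_{33}&R_{23}&0\\0&0&0&0\\0&0&R_{43}&R_{44}-R_{33}\end{bmatrix}$$ is (the matrix in the basis $\mathcal{B}$ of) a derivation of $\mathfrak{g}$.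
   Context: A pseudo-Riemannian inner product on a real Lie algebra $\mathfrak{g}$ is a nondegenerate symmetric bilinear form $\langle\cdot,\cdot\rangle$ on $\mathfrak{g}$ (of some signature $(r,s)$). Its Levi-Civita connection $\nabla$ is defined by $2\langle\nabla_uv,w\rangle=\langle[u,v],w\rangle+\langle[w,u],v\rangle+\langle[w,v],u\rangle$; its curvature is $R_{uv}=\nabla_{[u,v]}-[\nabla_u,\nabla_v]$; its Ricci curvature $\operatorname{ric}(u,v)$ is the trace of $w\mapsto R_{uw}v$; its Ricci operator $\operatorname{Ric}$ is the endomorphism of $\mathfrak{g}$ with $\langle\operatorname{Ric}(u),v\rangle=\operatorname{ric}(u,v)$. The matrix $(R_{ij})$ of $\operatorname{Ric}$ in a basis $\{e_i\}$ is given by $\operatorname{Ric}(e_j)=\sum_iR_{ij}e_i$ (the same column convention is used for $D$). A derivation is a linear map $D:\mathfrak{g}\to\mathfrak{g}$ with $D[x,y]=[D(x),y]+[x,D(y)]$ for all $x,y$. The inner product is an algebraic Ricci soliton if $\operatorname{Ric}=\eta\,\mathrm{Id}_{\mathfrak{g}}+D$ for some $\eta\in\mathbb{R}$ and some derivation $D$ of $\mathfrak{g}$. *)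

theory Defs
  imports "HOL-Analysis.Analysis"
begin

text \<open>
  Lie brackets and inner products live on the coordinate space \<open>real^'n\<close>; the basis vector
  \<open>e\<^sub>i\<close> is \<open>axis i 1\<close>, so that \<^term>\<open>matrix f\<close> is the matrix of \<open>f\<close> in this basis, with
  \<open>f e\<^sub>j = (\<Sum>i. (matrix f $ i $ j) *\<^sub>R e\<^sub>i)\<close>.
\<close>

definition lie_bracket :: "(real^'n \<Rightarrow> real^'n \<Rightarrow> real^'n) \<Rightarrow> bool" where
  "lie_bracket br \<longleftrightarrow> bilinear br \<and> (\<forall>x. br x x = 0) \<and>
     (\<forall>x y z. br x (br y z) + br y (br z x) + br z (br x y) = 0)"

definition pseudo_riemannian_inner_product :: "(real^'n \<Rightarrow> real^'n \<Rightarrow> real) \<Rightarrow> bool" where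
  "pseudo_riemannian_inner_product ip \<longleftrightarrow> bilinear ip \<and> (\<forall>x y. ip x y = ip y x) \<and>
     (\<forall>x. (\<forall>y. ip x y = 0) \<longrightarrow> x = 0)"

definition derivation :: "(real^'n \<Rightarrow> real^'n \<Rightarrow> real^'n) \<Rightarrow> (real^'n \<Rightarrow> real^'n) \<Rightarrow> bool" where
  "derivation br D \<longleftrightarrow> linear D \<and> (\<forall>x y. D (br x y) = br (D x) y + br x (D y))"

definition levi_civita ::
  "(real^'n \<Rightarrow> real^'n \<Rightarrow> real^'n) \<Rightarrow> (real^'n \<Rightarrow> real^'n \<Rightarrow> real) \<Rightarrow> real^'n \<Rightarrow> real^'n \<Rightarrow> real^'n" where
  "levi_civita br ip u v =
     (THE z. \<forall>w. 2 * ip z w = ip (br u v) w + ip (br w u) v + ip (br w v) u)"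

definition curvature ::
  "(real^'n \<Rightarrow> real^'n \<Rightarrow> real^'n) \<Rightarrow> (real^'n \<Rightarrow> real^'n \<Rightarrow> real) \<Rightarrow>
   real^'n \<Rightarrow> real^'n \<Rightarrow> real^'n \<Rightarrow> real^'n" where
  "curvature br ip u v x =
     levi_civita br ip (br u v) x
     - (levi_civita br ip u (levi_civita br ip v x) - levi_civita br ip v (levi_civita br ip u x))"

definition ricci_curvature ::
  "(real^'n \<Rightarrow> real^'n \<Rightarrow> real^'n) \<Rightarrow> (real^'n \<Rightarrow> real^'n \<Rightarrow> real) \<Rightarrow> real^'n \<Rightarrow> real^'n \<Rightarrow> real" where
  "ricci_curvature br ip u v = trace (matrix (\<lambda>w. curvature br ip u w v))"

definition ricci_operator ::
  "(real^'n \<Rightarrow> real^'n \<Rightarrow> real^'n) \<Rightarrow> (real^'n \<Rightarrow> real^'n \<Rightarrow> real) \<Rightarrow> real^'n \<Rightarrow> real^'n" where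
  "ricci_operator br ip u = (THE z. \<forall>v. ip z v = ricci_curvature br ip u v)"

definition algebraic_ricci_soliton ::
  "(real^'n \<Rightarrow> real^'n \<Rightarrow> real^'n) \<Rightarrow> (real^'n \<Rightarrow> real^'n \<Rightarrow> real) \<Rightarrow> bool" where
  "algebraic_ricci_soliton br ip \<longleftrightarrow>
     (\<exists>\<eta> D. derivation br D \<and> ricci_operator br ip = (\<lambda>x. \<eta> *\<^sub>R x + D x))"

text \<open>
  The bracket of \<open>g\<^sub>3\<^sub>.\<^sub>4\<^sup>0 \<oplus> g\<^sub>1\<close>: the bilinear alternating extension of
  \<open>[e\<^sub>2, e\<^sub>3] = e\<^sub>1\<close>, \<open>[e\<^sub>3, e\<^sub>1] = - e\<^sub>2\<close>.
\<close>

definition g34_g1_bracket :: "real^4 \<Rightarrow> real^4 \<Rightarrow> real^4" where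
  "g34_g1_bracket x y =
     (x$2 * y$3 - x$3 * y$2) *\<^sub>R axis 1 1 - (x$3 * y$1 - x$1 * y$3) *\<^sub>R axis 2 1"

lemma g34_g1_bracket_basis:
  "g34_g1_bracket (axis 2 1) (axis 3 1) = axis 1 1"
  "g34_g1_bracket (axis 3 1) (axis 1 1) = - axis 2 1"
  "g34_g1_bracket (axis 1 1) (axis 2 1) = 0"
  "g34_g1_bracket (axis i 1) (axis 4 1) = 0"
  by (auto simp: g34_g1_bracket_def axis_def vec_eq_iff)

lemma lie_bracket_g34_g1: "lie_bracket g34_g1_bracket"
  unfolding lie_bracket_def bilinear_def
  by (auto intro!: linearI simp: g34_g1_bracket_def vec_eq_iff forall_4 axis_def algebra_simps)

text \<open>
  Nondegeneracy makes the two definite descriptions above well defined.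
\<close>

lemma riesz_ex1:
  fixes f :: "real^'n \<Rightarrow> real"
  assumes "pseudo_riemannian_inner_product ip" and f: "linear f"
  shows "\<exists>!z. \<forall>w. ip z w = f w"
proof -
  have bl: "bilinear ip" and nd: "\<And>x. (\<And>y. ip x y = 0) \<Longrightarrow> x = 0"
    using assms(1) by (auto simp: pseudo_riemannian_inner_product_def)
  define T where "T z = (\<chi> i. ip z (axis i 1))" for z :: "real^'n"
  have lw: "linear (ip z)" for z
    using bl by (simp add: bilinear_def)
  have T: "linear T"
    by (rule linearI) (simp_all add: T_def vec_eq_iff bilinear_ladd[OF bl] bilinear_lmul[OF bl])
  have eq: "ip z w = g w" if "\<And>i. ip z (axis i 1) = g (axis i 1)" "linear g" for z w g
  proof (rule linear_eq_on_span[OF lw that(2), of "Basis"])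
    show "ip z b = g b" if "b \<in> Basis" for b
      using that \<open>\<And>i. ip z (axis i 1) = g (axis i 1)\<close> by (auto simp: Basis_vec_def)
    show "w \<in> span Basis" by simp
  qed
  have "inj T"
  proof (subst linear_injective_0[OF T], intro allI impI)
    fix x assume "T x = 0"
    then have "ip x (axis i 1) = 0" for i
      by (simp add: T_def vec_eq_iff)
    then have "ip x y = 0" for y
      by (rule eq[where g = "\<lambda>_. 0"]) (simp add: module_hom_zero)
    then show "x = 0" by (rule nd)
  qed
  then have "surj T"
    using T linear_injective_imp_surjective by blast
  then obtain z where "T z = (\<chi> i. f (axis i 1))"
    by (metis surjD)
  then have z: "\<forall>w. ip z w = f w"
    using eq[OF _ f] by (simp add: T_def vec_eq_iff)
  show ?thesis
  proof (rule ex1I[where a = z], rule z)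
    fix y assume "\<forall>w. ip y w = f w"
    with z have "ip (y - z) w = 0" for w
      by (simp add: bilinear_lsub[OF bl])
    then show "y = z" using nd[of "y - z"] by simp
  qed
qed

lemma levi_civita:
  assumes "lie_bracket br" and ip: "pseudo_riemannian_inner_product ip"
  shows "2 * ip (levi_civita br ip u v) w = ip (br u v) w + ip (br w u) v + ip (br w v) u"
proof -
  have bl: "bilinear ip" and br: "bilinear br"
    using assms by (auto simp: pseudo_riemannian_inner_product_def lie_bracket_def)
  let ?f = "\<lambda>w. (ip (br u v) w + ip (br w u) v + ip (br w v) u) / 2"
  have "linear ?f"
    by (rule linearI)
       (simp_all add: bilinear_ladd[OF bl] bilinear_radd[OF bl] bilinear_lmul[OF bl]
         bilinear_rmul[OF bl] bilinear_ladd[OF br] bilinear_lmul[OF br] field_simps)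
  from riesz_ex1[OF ip this]
  have "\<exists>!z. \<forall>w. 2 * ip z w = ip (br u v) w + ip (br w u) v + ip (br w v) u"
    by (simp add: field_simps)
  from theI'[OF this] show ?thesis
    by (simp add: levi_civita_def)
qed

lemma bilinear_levi_civita:
  assumes lb: "lie_bracket br" and ip: "pseudo_riemannian_inner_product ip"
  shows "bilinear (levi_civita br ip)"
proof -
  have bl: "bilinear ip" and br: "bilinear br"
    using assms by (auto simp: pseudo_riemannian_inner_product_def lie_bracket_def)
  note lc = levi_civita[OF assms]
  have eqI: "x = y" if "\<And>w. 2 * ip x w = 2 * ip y w" for x y
  proof -
    have "\<forall>w. ip (x - y) w = 0" using that by (simp add: bilinear_lsub[OF bl])
    then have "x - y = 0" using ip unfolding pseudo_riemannian_inner_product_def by blast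
    then show ?thesis by simp
  qed
  note lin = bilinear_ladd[OF bl] bilinear_radd[OF bl] bilinear_lmul[OF bl]
    bilinear_rmul[OF bl] bilinear_ladd[OF br] bilinear_lmul[OF br]
    bilinear_radd[OF br] bilinear_rmul[OF br]
  have lmul: "2 * ip (c *\<^sub>R x) w = c * (2 * ip x w)" for c x w
    by (simp add: lin)
  show ?thesis
    unfolding bilinear_def
    by (intro conjI allI linearI eqI)
       (simp_all only: lmul bilinear_ladd[OF bl] distrib_left lc, simp_all add: lin algebra_simps)
qed

lemma ricci_operator:
  assumes lb: "lie_bracket br" and ip: "pseudo_riemannian_inner_product ip"
  shows "ip (ricci_operator br ip u) v = ricci_curvature br ip u v"
proof -
  note lc = bilinear_levi_civita[OF assms]
  have "linear (ricci_curvature br ip u)"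
    by (rule linearI)
       (simp_all add: ricci_curvature_def curvature_def trace_def matrix_def bilinear_radd[OF lc]
         bilinear_rmul[OF lc] sum.distrib sum_distrib_left sum_subtractf algebra_simps)
  from theI'[OF riesz_ex1[OF ip this]] show ?thesis
    by (simp add: ricci_operator_def)
qed

end

theory Submission
  imports Defs
begin

text \<open>
  No curvature has to be computed: every matrix of the shape of \<open>D\<close> is a derivation, whatever
  its entries, and the hypotheses on \<open>R\<close> say that \<open>R - R\<^sub>3\<^sub>3 I\<close> has this shape.
\<close>

text \<open>A matrix determines only a linear map, so this is what lets hypotheses on the entries of
  \<open>R\<close> speak about the Ricci operator itself.\<close>

lemma linear_ricci_operator:
  assumes lb: "lie_bracket br" and ip: "pseudo_riemannian_inner_product ip"
  shows "linear (ricci_operator br ip)"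
proof -
  have bl: "bilinear ip" and br: "bilinear br"
    using assms by (auto simp: pseudo_riemannian_inner_product_def lie_bracket_def)
  have eqI: "x = y" if "\<And>w. ip x w = ip y w" for x y
  proof -
    have "\<forall>w. ip (x - y) w = 0" using that by (simp add: bilinear_lsub[OF bl])
    then have "x - y = 0" using ip unfolding pseudo_riemannian_inner_product_def by blast
    then show ?thesis by simp
  qed
  note lc = bilinear_levi_civita[OF assms]
  \<comment> \<open>Each diagonal entry in the trace is linear in \<open>u\<close>, because the
    bracket and the connection are bilinear.\<close>
  have ric: "linear (\<lambda>u. ricci_curvature br ip u v)" for v
    by (rule linearI)
       (simp_all add: ricci_curvature_def curvature_def trace_def matrix_def
         bilinear_ladd[OF lc] bilinear_lmul[OF lc] bilinear_radd[OF lc] bilinear_rmul[OF lc]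
         bilinear_ladd[OF br] bilinear_lmul[OF br]
         sum.distrib sum_distrib_left sum_subtractf algebra_simps)
  show ?thesis
    by (intro linearI eqI)
       (simp_all add: ricci_operator[OF assms] bilinear_ladd[OF bl] bilinear_lmul[OF bl]
         linear_add[OF ric] linear_cmul[OF ric])
qed

lemma vector_4:
  "(vector [a, b, c, d] :: 'a::zero^4) $ 1 = a"
  "(vector [a, b, c, d] :: 'a^4) $ 2 = b"
  "(vector [a, b, c, d] :: 'a^4) $ 3 = c"
  "(vector [a, b, c, d] :: 'a^4) $ 4 = d"
  by (simp_all add: vector_def)

text \<open>The bracket is the action of \<open>- ad e3\<close>, which swaps \<open>e1\<close> and
  \<open>e2\<close>, on their abelian span, with \<open>e4\<close> central. The block with rows
  \<open>a, b\<close> and \<open>b, a\<close> commutes with the swap. The image of \<open>e3\<close>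
  has no \<open>e3\<close> component, so it acts trivially on that span, and \<open>e4\<close> goes
  to a multiple of itself.\<close>

lemma derivation_g34_g1:
  fixes D :: "real^4^4"
  assumes "D = vector
      [vector [a, b, p, 0],
       vector [b, a, q, 0],
       vector [0, 0, 0, 0],
       vector [0, 0, r, s]]"
  shows "derivation g34_g1_bracket (\<lambda>x. D *v x)"
  unfolding derivation_def g34_g1_bracket_def assms
  by (auto simp: vec_eq_iff forall_4 axis_def matrix_vector_mult_def sum_4 vector_4 algebra_simps)

theorem theorem3p6:
  fixes ip :: "real^4 \<Rightarrow> real^4 \<Rightarrow> real" and R D :: "real^4^4"
  assumes "pseudo_riemannian_inner_product ip"
    and R: "R = matrix (ricci_operator g34_g1_bracket ip)"
    and "R$3$1 = 0" "R$4$1 = 0" "R$3$2 = 0" "R$4$2 = 0"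
    and "R$1$4 = 0" "R$2$4 = 0" "R$3$4 = 0"
    and "R$2$1 = R$1$2" "R$2$2 = R$1$1"
    and D: "D = vector
      [vector [R$1$1 - R$3$3, R$1$2,           R$1$3, 0],
       vector [R$1$2,           R$1$1 - R$3$3, R$2$3, 0],
       vector [0,               0,             0,     0],
       vector [0,               0,             R$4$3, R$4$4 - R$3$3]]"
  shows "algebraic_ricci_soliton g34_g1_bracket ip
    \<and> ricci_operator g34_g1_bracket ip = (\<lambda>x. (R$3$3 *\<^sub>R mat 1 + D) *v x)
    \<and> derivation g34_g1_bracket (\<lambda>x. D *v x)"
proof -
  have der: "derivation g34_g1_bracket (\<lambda>x. D *v x)"
    by (rule derivation_g34_g1[OF D])
  \<comment> \<open>The choice of \<open>R$3$3\<close> as soliton constant makes the (3,3) entry of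
    \<open>D\<close> vanish, as its shape demands.\<close>
  have "R = R$3$3 *\<^sub>R mat 1 + D"
    using assms(3-11) by (simp add: D vec_eq_iff forall_4 mat_def vector_4)
  moreover have "ricci_operator g34_g1_bracket ip = (\<lambda>x. R *v x)"
    unfolding R
    by (rule matrix_vector_mul(2)[symmetric, OF linear_ricci_operator[OF lie_bracket_g34_g1 assms(1)]])
  ultimately have ric: "ricci_operator g34_g1_bracket ip = (\<lambda>x. (R$3$3 *\<^sub>R mat 1 + D) *v x)"
    by metis
  then have "ricci_operator g34_g1_bracket ip = (\<lambda>x. R$3$3 *\<^sub>R x + D *v x)"
    by (simp add: matrix_vector_mult_add_rdistrib scaleR_matrix_vector_assoc[symmetric])
  with der ric show ?thesis
    unfolding algebraic_ricci_soliton_def by blast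
qed

end
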